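(* If $\beta$ is a positive probability measure on $\Sigma$, then, for each sequence $S\in\Sigma^\infty$, \[\dim_{\mathrm{FS}}^\beta(S)=\inf_C\liminf_{w\rightarrow S} \frac{|C(w)|}{ \mathcal{I}_\beta(w)},\] and \[\mathrm{Dim}_{\mathrm{FS}}^\beta(S)=\inf_C\limsup_{w\rightarrow S} \frac{|C(w)|}{\mathcal{I}_\beta(w)},\] where the infima are taken over all information-lossless finite-state compressors (ILFSCs) $C$.
   Context: $\Sigma=\{0,1,\dots,k-1\}$ is a finite alphabet with $k\geq 2$; $\Sigma^*$ and $\Sigma^\infty$ denote the finite strings and infinite sequences over $\Sigma$. A probability measure $\beta$ on $\Sigma$ is positive if $\beta(a)>0$ for all $a\in\Sigma$; it extends to strings by $\beta(w)=\prod_{i=0}^{|w|-1}\beta(w[i])$, and $\mu$ denotes the uniform measure, $\mu(w)=k^{-|w|}$. The Shannon self-information of $w$ with respect to $\beta$ is $\mathcal{I}_\beta(w)=\sum_{i=0}^{|w|-1}\log\frac{1}{\beta(w[i])}$ (logs base 2). $\liminf_{w\to S}$ and $\limsup_{w\to S}$ are taken over prefixes $w$ of $S$ as they grow. A finite-state gambler (FSG) is $G=(Q,\delta,q_0,B)$ with finite state set $Q$, transition function $\delta:Q\times\Sigma\to Q$ (extended to $\delta(w)$ = state reached from $q_0$ on input $w$), initial state $q_0$, and betting function $B$ mapping each state to a rational-valued probability measure on $\Sigma$. Its martingale is $d_G(\lambda)=1$, $d_G(wa)=k\,d_G(w)\,B(\delta(w))(a)$, and its $s$-$\beta$-gale is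 $d^{(s)}_{G,\beta}(w)=\frac{\mu(w)}{\beta(w)^s}d_G(w)$. A gale $d$ succeeds on $S$ if $\limsup_{w\to S}d(w)=\infty$, and succeeds strongly if $\liminf_{w\to S}d(w)=\infty$. The finite-state $\beta$-dimension $\dim_{\mathrm{FS}}^\beta(S)$ is the infimum of all $s\in[0,\infty)$ such that $d^{(s)}_{G,\beta}$ succeeds on $S$ for some FSG $G$; the finite-state strong $\beta$-dimension $\mathrm{Dim}_{\mathrm{FS}}^\beta(S)$ is the same with strong success. A finite-state compressor (FSC) is $C=(Q,\delta,q_0,\nu)$ with $Q,\delta,q_0$ as for an FSG and output function $\nu:Q\times\Sigma\to\{0,1\}^*$; its output is $C(\lambda)=\lambda$, $C(wa)=C(w)\nu(\delta(w),a)$. An ILFSC is an FSC for which the map $w\mapsto(C(w),\delta(w))$ is one-to-one. $|C(w)|$ is the number of bits output on input $w$. *)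

theory Defs
  imports "HOL-Probability.Probability"
begin

text \<open>
  The alphabet is a finite type \<open>'a\<close> with \<open>k = CARD('a)\<close> letters, strings are lists and
  infinite sequences are functions on \<open>nat\<close>. Measures on the alphabet are \<open>pmf\<close>s.
  Every finite set of states can be renamed to a finite set of natural numbers, so automata
  carry states of type \<open>nat\<close>; only the behaviour on \<open>states\<close> matters.
\<close>

definition seq_prefix :: "(nat \<Rightarrow> 'a) \<Rightarrow> nat \<Rightarrow> 'a list" where
  "seq_prefix S n = map S [0..<n]"

definition positive_pmf :: "'a pmf \<Rightarrow> bool" where
  "positive_pmf \<beta> \<longleftrightarrow> (\<forall>a. 0 < pmf \<beta> a)"

definition string_prob :: "'a pmf \<Rightarrow> 'a list \<Rightarrow> real" where
  "string_prob \<beta> w = (\<Prod>i<length w. pmf \<beta> (w ! i))"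

definition uniform_prob :: "'a::finite list \<Rightarrow> real" where
  "uniform_prob w = 1 / real CARD('a) ^ length w"

definition self_information :: "'a pmf \<Rightarrow> 'a list \<Rightarrow> real" where
  "self_information \<beta> w = (\<Sum>i<length w. log 2 (1 / pmf \<beta> (w ! i)))"

record 'a automaton =
  states :: "nat set"
  step :: "nat \<Rightarrow> 'a \<Rightarrow> nat"
  start :: nat

record 'a gambler = "'a automaton" +
  bet :: "nat \<Rightarrow> 'a pmf"

record 'a compressor = "'a automaton" +
  emit :: "nat \<Rightarrow> 'a \<Rightarrow> bool list"

definition finite_automaton :: "('a, 'm) automaton_scheme \<Rightarrow> bool" where
  "finite_automaton A \<longleftrightarrow> finite (states A) \<and> start A \<in> states A
     \<and> (\<forall>q\<in>states A. \<forall>a. step A q a \<in> states A)"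

definition run :: "('a, 'm) automaton_scheme \<Rightarrow> 'a list \<Rightarrow> nat" where
  "run A w = foldl (step A) (start A) w"

definition FSG :: "'a gambler set" where
  "FSG = {G. finite_automaton G \<and> (\<forall>q\<in>states G. \<forall>a. pmf (bet G q) a \<in> \<rat>)}"

function martingale :: "'a::finite gambler \<Rightarrow> 'a list \<Rightarrow> real" where
  "martingale G [] = 1"
| "martingale G (w @ [a]) = real CARD('a) * martingale G w * pmf (bet G (run G w)) a"
  by (auto, metis rev_exhaust)
termination by (relation "Wellfounded.measure (\<lambda>(G, w). length w)") auto

text \<open>For positive \<open>\<beta>\<close> the base of \<open>powr\<close> is positive and no division by zero occurs.\<close>

definition gale :: "'a::finite gambler \<Rightarrow> real \<Rightarrow> 'a pmf \<Rightarrow> 'a list \<Rightarrow> real" where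
  "gale G s \<beta> w = uniform_prob w / string_prob \<beta> w powr s * martingale G w"

definition succeeds :: "('a list \<Rightarrow> real) \<Rightarrow> (nat \<Rightarrow> 'a) \<Rightarrow> bool" where
  "succeeds d S \<longleftrightarrow> limsup (\<lambda>n. ereal (d (seq_prefix S n))) = \<infinity>"

definition succeeds_strongly :: "('a list \<Rightarrow> real) \<Rightarrow> (nat \<Rightarrow> 'a) \<Rightarrow> bool" where
  "succeeds_strongly d S \<longleftrightarrow> liminf (\<lambda>n. ereal (d (seq_prefix S n))) = \<infinity>"

text \<open>The infima are taken in \<open>ereal\<close>, so that the infimum of the empty set would be \<open>\<infinity>\<close>.\<close>

definition dim_FS :: "'a::finite pmf \<Rightarrow> (nat \<Rightarrow> 'a) \<Rightarrow> ereal" where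
  "dim_FS \<beta> S = Inf (ereal ` {s. 0 \<le> s \<and> (\<exists>G\<in>FSG. succeeds (gale G s \<beta>) S)})"

definition strong_dim_FS :: "'a::finite pmf \<Rightarrow> (nat \<Rightarrow> 'a) \<Rightarrow> ereal" where
  "strong_dim_FS \<beta> S = Inf (ereal ` {s. 0 \<le> s \<and> (\<exists>G\<in>FSG. succeeds_strongly (gale G s \<beta>) S)})"

function compress :: "'a compressor \<Rightarrow> 'a list \<Rightarrow> bool list" where
  "compress C [] = []"
| "compress C (w @ [a]) = compress C w @ emit C (run C w) a"
  by (auto, metis rev_exhaust)
termination by (relation "Wellfounded.measure (\<lambda>(C, w). length w)") auto

definition ILFSC :: "'a compressor set" where
  "ILFSC = {C. finite_automaton C \<and> inj (\<lambda>w. (compress C w, run C w))}"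

text \<open>
  On the empty prefix the ratio is \<open>0 / 0 = 0\<close>, which does not affect the lower and upper limits.
\<close>

definition compression_ratio :: "'a compressor \<Rightarrow> 'a pmf \<Rightarrow> 'a list \<Rightarrow> real" where
  "compression_ratio C \<beta> w = real (length (compress C w)) / self_information \<beta> w"

end

theory Submission
  imports Defs
begin

text \<open>
  Let \<open>P\<close> be the product of the bets of a gambler along \<open>w\<close>, so that its \<open>s\<close>-\<open>\<beta>\<close>-gale is
  \<open>2\<^bsup>s I(w)\<^esup> P(w)\<close>. It suffices to turn a compressor \<open>C\<close> into a gambler with \<open>log (1 / P(w))\<close> at most
  \<open>|C(w)| + \<epsilon> |w| + O(1)\<close>, and conversely a gambler into a compressor with \<open>|C(w)|\<close> at most
  \<open>(1 + \<epsilon>) log (1 / P(w)) + \<epsilon> |w|\<close>: since \<open>\<beta>\<close> is positive on at least two letters, \<open>I(w)\<close> grows at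
  least linearly in \<open>|w|\<close>. For the first, information losslessness makes \<open>\<Sum> 2\<^bsup>-|C\<^sub>q(v)|\<^esup>\<close> over the words
  \<open>v\<close> of length \<open>j\<close> grow only linearly in \<open>j\<close>, so the weights \<open>2\<^bsup>-|\<nu>(q,a)|\<^esup>\<close> can be normalised
  to bets at a cost \<open>\<epsilon>\<close> per letter. For the second, long blocks are encoded by prefix codes whose
  codeword lengths are close to \<open>log (1 / P)\<close>.
\<close>


subsection \<open>Words and runs\<close>

lemma finite_words: "finite {v :: 'a::finite list. length v = n}"
  using finite_lists_length_eq[of "UNIV :: 'a set" n] by simp

lemma sum_words_Suc:
  fixes f :: "'a::finite list \<Rightarrow> real"
  shows "(\<Sum>v | length v = Suc n. f v) = (\<Sum>a\<in>UNIV. \<Sum>v | length v = n. f (a # v))"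
proof -
  have "(\<Sum>v | length v = Suc n. f v)
      = (\<Sum>(a, v) \<in> UNIV \<times> {v. length v = n}. f (a # v))"
    by (rule sum.reindex_bij_witness[where i = "\<lambda>(a, v). a # v" and j = "\<lambda>v. (hd v, tl v)"])
       (auto simp: length_Suc_conv)
  then show ?thesis
    by (simp add: sum.cartesian_product)
qed

text \<open>Product of the bets from an arbitrary state, without the factor \<open>CARD('a)\<close>.
  Recursion on the front letter, unlike in \<open>martingale\<close>, lets a word be cut into blocks
  that are read from different states.\<close>

primrec word_prob :: "'a gambler \<Rightarrow> nat \<Rightarrow> 'a list \<Rightarrow> real" where
  "word_prob G q [] = 1"
| "word_prob G q (a # w) = pmf (bet G q) a * word_prob G (step G q a) w"

primrec word_output :: "'a compressor \<Rightarrow> nat \<Rightarrow> 'a list \<Rightarrow> bool list" where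
  "word_output C q [] = []"
| "word_output C q (a # w) = emit C q a @ word_output C (step C q a) w"

lemma word_prob_append:
  "word_prob G q (u @ v) = word_prob G q u * word_prob G (foldl (step G) q u) v"
  by (induction u arbitrary: q) auto

lemma word_output_append:
  "word_output C q (u @ v) = word_output C q u @ word_output C (foldl (step C) q u) v"
  by (induction u arbitrary: q) auto

lemma word_prob_nonneg: "0 \<le> word_prob G q w"
  by (induction w arbitrary: q) auto

lemma word_prob_le_1: "word_prob G q w \<le> 1"
  by (induction w arbitrary: q) (auto intro!: mult_le_one pmf_le_1 word_prob_nonneg)

lemma sum_word_prob:
  fixes G :: "'a::finite gambler"
  shows "(\<Sum>v | length v = n. word_prob G q v) = 1"
proof (induction n arbitrary: q)
  case 0
  have "{v :: 'a list. length v = 0} = {[]}" by auto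
  then show ?case by simp
next
  case (Suc n)
  show ?case
    by (simp add: sum_words_Suc Suc sum_pmf_eq_1 flip: sum_distrib_left)
qed

lemma martingale_eq_word_prob:
  "martingale G w = real CARD('a) ^ length w * word_prob G (start G) (w :: 'a::finite list)"
  by (induction w rule: rev_induct) (auto simp: word_prob_append run_def)

lemma compress_eq_word_output: "compress C w = word_output C (start C) w"
  by (induction w rule: rev_induct) (auto simp: word_output_append run_def)

lemma foldl_step_in_states:
  "finite_automaton A \<Longrightarrow> q \<in> states A \<Longrightarrow> foldl (step A) q w \<in> states A"
  by (induction w arbitrary: q) (auto simp: finite_automaton_def)

lemma run_in_states: "finite_automaton A \<Longrightarrow> run A w \<in> states A"
  using foldl_step_in_states[of A "start A" w] by (simp add: run_def finite_automaton_def)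

text \<open>The powers of \<open>CARD('a)\<close> in the martingale and in the uniform measure
  cancel, and \<open>string_prob \<beta> w\<close> is 2 to the power of minus the
  self-information.\<close>

lemma gale_eq:
  fixes \<beta> :: "'a::finite pmf"
  assumes "positive_pmf \<beta>"
  shows "gale G s \<beta> w = 2 powr (s * self_information \<beta> w) * word_prob G (start G) w"
proof -
  have pos: "pmf \<beta> a > 0" for a
    using assms by (simp add: positive_pmf_def)
  have "string_prob \<beta> w = 2 powr (- self_information \<beta> w)"
    by (simp add: string_prob_def self_information_def powr_minus powr_sum divide_inverse
        log_inverse pos less_imp_neq[OF pos, symmetric] flip: prod_inversef)
  then have "string_prob \<beta> w powr s = 2 powr (- (s * self_information \<beta> w))"
    by (simp add: powr_powr mult.commute)
  then show ?thesis
    by (simp add: gale_def uniform_prob_def martingale_eq_word_prob powr_minus divide_inverse)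
qed

text \<open>A second letter of positive probability keeps every probability below 1, so each letter
  carries positive information; the minimum over the finite alphabet serves as \<open>c\<close>.
  This converts costs per letter into costs per bit of information.\<close>

lemma self_information_ge_linear:
  fixes \<beta> :: "'a::finite pmf"
  assumes "CARD('a) \<ge> 2" and "positive_pmf \<beta>"
  obtains c where "c > 0" and "\<And>w. c * real (length w) \<le> self_information \<beta> w"
proof -
  have pos: "pmf \<beta> a > 0" for a
    using assms by (simp add: positive_pmf_def)
  have lt: "pmf \<beta> a < 1" for a
  proof -
    have "\<exists>b. b \<noteq> a"
    proof (rule ccontr)
      assume "\<not> ?thesis"
      then have "(UNIV :: 'a set) = {a}" by auto
      then have "CARD('a) = 1" by (metis card_1_singleton_iff One_nat_def)
      with assms show False by simp
    qed
    then obtain b where "b \<noteq> a" ..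
    have "pmf \<beta> a + pmf \<beta> b = (\<Sum>x\<in>{a, b}. pmf \<beta> x)"
      using \<open>b \<noteq> a\<close> by simp
    also have "\<dots> \<le> (\<Sum>x\<in>UNIV. pmf \<beta> x)"
      by (rule sum_mono2) auto
    also have "\<dots> = 1" by (simp add: sum_pmf_eq_1)
    finally show ?thesis using pos[of b] by linarith
  qed
  define c where "c = Min (range (\<lambda>a. log 2 (1 / pmf \<beta> a)))"
  have le: "c \<le> log 2 (1 / pmf \<beta> a)" for a
    unfolding c_def by (rule Min_le) auto
  have "c \<in> range (\<lambda>a. log 2 (1 / pmf \<beta> a))"
    unfolding c_def by (rule Min_in) auto
  then have "c > 0" using pos lt by auto
  moreover have "c * real (length w) \<le> self_information \<beta> w" for w
    unfolding self_information_def
    using sum_bounded_below[of "{..<length w}" c "\<lambda>i. log 2 (1 / pmf \<beta> (w ! i))"] le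
    by (simp add: mult.commute)
  ultimately show thesis by (rule that)
qed

subsection \<open>From compressors to gamblers\<close>

text \<open>The entry at \<open>q\<close> of the \<open>j\<close>-th power of the transition weight
  matrix applied to the all-ones vector, that is, a Kraft sum over the words of length
  \<open>j\<close> read from \<open>q\<close>. The recursive form gives rationality by
  induction.\<close>

primrec output_weight :: "'a::finite compressor \<Rightarrow> nat \<Rightarrow> nat \<Rightarrow> real" where
  "output_weight C 0 q = 1"
| "output_weight C (Suc j) q =
    (\<Sum>a\<in>UNIV. (1/2) ^ length (emit C q a) * output_weight C j (step C q a))"

lemma output_weight_eq:
  fixes C :: "'a::finite compressor"
  shows "output_weight C j q = (\<Sum>v | length v = j. (1/2) ^ length (word_output C q v))"
proof (induction j arbitrary: q)
  case 0
  have "{v :: 'a list. length v = 0} = {[]}" by auto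
  then show ?case by simp
next
  case (Suc j)
  then show ?case by (simp add: sum_words_Suc power_add sum_distrib_left)
qed

lemma output_weight_nonneg: "0 \<le> output_weight C j q"
  by (simp add: output_weight_eq sum_nonneg)

lemma output_weight_Rats: "output_weight C j q \<in> \<rat>"
  by (induction j arbitrary: q) (auto intro!: Rats_sum)

lemma finite_bool_lists: "finite {x :: bool list. length x \<le> N}"
  using finite_lists_length_le[of "UNIV :: bool set" N] by simp

lemma card_bool_lists: "card {x :: bool list. length x = N} = 2 ^ N"
  using card_lists_length_eq[of "UNIV :: bool set" N] by simp

text \<open>Each length from 0 to \<open>N\<close> contributes exactly 1. This is the source of the
  linear growth of the Kraft sums.\<close>

lemma sum_bool_lists_weight: "(\<Sum>x | length (x :: bool list) \<le> N. (1/2 :: real) ^ length x) = real N + 1"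
proof (induction N)
  case 0
  have "{v :: bool list. length v \<le> 0} = {[]}" by auto
  then show ?case by simp
next
  case (Suc N)
  have "{x :: bool list. length x \<le> Suc N} = {x. length x \<le> N} \<union> {x. length x = Suc N}" by auto
  then have "(\<Sum>x | length (x :: bool list) \<le> Suc N. (1/2 :: real) ^ length x)
      = (\<Sum>x | length (x :: bool list) \<le> N. (1/2 :: real) ^ length x)
        + (\<Sum>x | length (x :: bool list) = Suc N. (1/2 :: real) ^ length x)"
    by (simp only:) (rule sum.union_disjoint, auto simp: finite_words finite_bool_lists)
  also have "(\<Sum>x | length (x :: bool list) = Suc N. (1/2 :: real) ^ length x) = 1"
    by (simp add: card_bool_lists power_divide del: power_Suc)
  finally show ?case using Suc by simp
qed

text \<open>From a reachable state the pair of output and final state determines the word, since a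
  common prefix \<open>u\<close> can be put in front. The Kraft sum is thus at most one sum over
  short bit strings for each final state. Losslessness says nothing about unreachable states, hence
  \<open>run C u\<close>.\<close>

lemma ILFSC_output_weight_bound:
  fixes C :: "'a::finite compressor"
  assumes "C \<in> ILFSC"
  obtains K :: real where "\<And>j u. output_weight C j (run C u) \<le> K * (real j + 1)"
proof -
  have fa: "finite_automaton C" and inj: "inj (\<lambda>w. (compress C w, run C w))"
    using assms by (auto simp: ILFSC_def)
  have fin: "finite (states C)" using fa by (simp add: finite_automaton_def)
  define L where "L = Max ((\<lambda>(q, a). length (emit C q a)) ` (states C \<times> UNIV))"
  have L: "length (emit C q a) \<le> L" if "q \<in> states C" for q a
    unfolding L_def by (rule Max_ge) (use that fin in force)+
  have out_le: "length (word_output C q v) \<le> L * length v" if "q \<in> states C" for q v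
    using that
  proof (induction v arbitrary: q)
    case (Cons a v)
    then have "step C q a \<in> states C" using fa by (auto simp: finite_automaton_def)
    with Cons.IH[OF this] L[OF Cons.prems, of a] show ?case by simp
  qed simp
  have bound: "output_weight C j (run C u) \<le> real (card (states C)) * (real (L * j) + 1)" for j u
  proof -
    let ?q = "run C u"
    let ?h = "\<lambda>v. (word_output C ?q v, foldl (step C) ?q v)"
    have "inj_on ?h {v. length v = j}"
    proof (rule inj_onI)
      fix v v' assume eq: "?h v = ?h v'"
      have "(compress C (u @ v), run C (u @ v)) = (compress C (u @ v'), run C (u @ v'))"
        using eq by (simp add: compress_eq_word_output word_output_append run_def)
      then have "u @ v = u @ v'" by (rule injD[OF inj])
      then show "v = v'" by simp
    qed
    then have "output_weight C j ?q
        = (\<Sum>(x, p) \<in> ?h ` {v. length v = j}. (1/2) ^ length x)"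
      by (simp add: output_weight_eq sum.reindex)
    also have "\<dots> \<le> (\<Sum>(x :: bool list, p) \<in> {x. length x \<le> L * j} \<times> states C. (1/2) ^ length x)"
    proof (rule sum_mono2)
      show "?h ` {v. length v = j} \<subseteq> {x. length x \<le> L * j} \<times> states C"
      proof clarsimp
        fix v :: "'a list"
        assume "j = length v"
        have "run C (u @ v) \<in> states C" by (rule run_in_states[OF fa])
        then show "length (word_output C ?q v) \<le> L * length v \<and> foldl (step C) ?q v \<in> states C"
          using out_le[OF run_in_states[OF fa]] by (simp add: run_def)
      qed
    qed (auto simp: fin finite_bool_lists)
    also have "\<dots> = real (card (states C)) * (\<Sum>x | length (x :: bool list) \<le> L * j. (1/2) ^ length x)"
      by (simp add: sum_distrib_left flip: sum.cartesian_product)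
    finally show ?thesis by (simp add: sum_bool_lists_weight)
  qed
  show thesis
  proof (rule that)
    fix j u
    have "real (L * j) + 1 \<le> (real L + 1) * (real j + 1)" by (simp add: algebra_simps)
    then have "real (card (states C)) * (real (L * j) + 1)
        \<le> real (card (states C)) * ((real L + 1) * (real j + 1))"
      by (rule mult_left_mono) simp
    with bound[of j u] show "output_weight C j (run C u)
        \<le> real (card (states C)) * (real L + 1) * (real j + 1)"
      by (simp add: mult.assoc)
  qed
qed

text \<open>Let \<open>A\<close> be the matrix of the weights \<open>2\<^bsup>-|\<nu>(q,a)|\<^esup>\<close> of the transitions. The gambler bets in
  proportion to \<open>2\<^bsup>-|\<nu>(q,a)|\<^esup> * h (\<delta>(q,a))\<close>, where \<open>h q = (\<Sum>j<l. \<rho> ^ j * output_weight C j q)\<close> is a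
  truncation of the resolvent \<open>(1 - \<rho> A)\<^bsup>-1\<^esup> 1\<close>. Truncating keeps \<open>h\<close> rational, and
  \<open>\<rho> * (A h) q \<le> h q\<close> still holds once \<open>\<rho> ^ l * output_weight C l q \<le> 1\<close>.\<close>

lemma gambler_of_compressor:
  fixes C :: "'a::finite compressor"
  assumes C: "C \<in> ILFSC" and \<rho>: "\<rho> \<in> \<rat>" "0 < \<rho>" "\<rho> < 1"
  obtains G K where "G \<in> FSG" and "K > 0"
    and "\<And>w. word_prob G (start G) w \<ge> K * (1/2) ^ length (compress C w) * \<rho> ^ length w"
proof -
  obtain B :: real where B: "\<And>j u. output_weight C j (run C u) \<le> B * (real j + 1)"
    by (rule ILFSC_output_weight_bound[OF C]) blast
  \<comment> \<open>Geometric decay beats the linear bound on \<open>output_weight\<close>, so one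
    truncation length \<open>l\<close> serves all reachable states. Requiring \<open>l > 0\<close>
    keeps the term for \<open>j = 0\<close>, which gives \<open>h q \<ge> 1\<close>.\<close>
  have "(\<lambda>l. B * (real l * \<rho> ^ l + \<rho> ^ l)) \<longlonglongrightarrow> B * (0 + 0)"
    using \<rho> by (intro tendsto_intros powser_times_n_limit_0 LIMSEQ_realpow_zero) auto
  then have "\<forall>\<^sub>F l in sequentially. B * (real l * \<rho> ^ l + \<rho> ^ l) < 1"
    by (rule order_tendstoD(2)) simp
  then have "\<forall>\<^sub>F l in sequentially. B * (real l * \<rho> ^ l + \<rho> ^ l) < 1 \<and> l > 0"
    using eventually_gt_at_top by eventually_elim auto
  then obtain l where l: "B * (real l * \<rho> ^ l + \<rho> ^ l) < 1" "l > 0"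
    by (auto simp: eventually_sequentially)
  define W where "W = output_weight C"
  define h where "h q = (\<Sum>j<l. \<rho> ^ j * W j q)" for q
  define wt where "wt q a = (1/2) ^ length (emit C q a) * h (step C q a)" for q a
  have h_ge: "1 \<le> h q" for q
  proof -
    have "1 = (\<Sum>j\<in>{0::nat}. \<rho> ^ j * W j q)" by (simp add: W_def)
    also have "\<dots> \<le> h q" unfolding h_def
      by (rule sum_mono2) (use l \<rho> in \<open>auto simp: W_def intro!: mult_nonneg_nonneg output_weight_nonneg\<close>)
    finally show ?thesis .
  qed
  then have h_pos: "0 < h q" for q by (meson less_le_trans zero_less_one)
  have h_Rats: "h q \<in> \<rat>" for q
    using \<rho> by (auto simp: h_def W_def intro!: Rats_sum Rats_mult Rats_power output_weight_Rats)
  have wt_pos: "wt q a > 0" for q a using h_pos by (simp add: wt_def)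
  then have sum_pos: "(\<Sum>b\<in>UNIV. wt q b) > 0" for q by (intro sum_pos) auto
  define G :: "'a gambler" where
    "G = \<lparr>states = states C, step = step C, start = start C,
          bet = \<lambda>q. embed_pmf (\<lambda>a. wt q a / (\<Sum>b\<in>UNIV. wt q b))\<rparr>"
  have bet: "pmf (bet G q) a = wt q a / (\<Sum>b\<in>UNIV. wt q b)" for q a
    unfolding G_def gambler.simps
  proof (rule pmf_embed_pmf)
    show "0 \<le> wt q x / (\<Sum>b\<in>UNIV. wt q b)" for x
      using wt_pos sum_pos by (simp add: less_imp_le)
    have "(\<Sum>x\<in>UNIV. wt q x / (\<Sum>b\<in>UNIV. wt q b)) = 1"
      using sum_pos[of q] by (simp flip: sum_divide_distrib)
    then show "(\<integral>\<^sup>+ x. ennreal (wt q x / (\<Sum>b\<in>UNIV. wt q b)) \<partial>count_space UNIV) = 1"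
      using wt_pos sum_pos
      by (simp add: nn_integral_count_space_finite sum_ennreal less_imp_le)
  qed
  have "G \<in> FSG"
  proof -
    have "pmf (bet G q) a \<in> \<rat>" for q a
      unfolding bet wt_def using h_Rats by (auto intro!: Rats_divide Rats_sum)
    moreover have "finite_automaton G"
      using C by (simp add: ILFSC_def finite_automaton_def G_def)
    ultimately show ?thesis by (simp add: FSG_def)
  qed
  have sum_wt: "\<rho> * (\<Sum>a\<in>UNIV. wt (run C u) a) \<le> h (run C u)" for u
  proof -
    let ?q = "run C u"
    have "(\<Sum>a\<in>UNIV. wt ?q a) = (\<Sum>j<l. \<rho> ^ j * W (Suc j) ?q)"
      unfolding wt_def h_def W_def output_weight.simps sum_distrib_left
      by (subst sum.swap) (simp add: mult_ac)
    then have "\<rho> * (\<Sum>a\<in>UNIV. wt ?q a) = (\<Sum>j<l. \<rho> ^ Suc j * W (Suc j) ?q)"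
      by (simp add: sum_distrib_left mult_ac)
    \<comment> \<open>The subtracted 1 is the term for \<open>j = 0\<close>; it absorbs the term for
      \<open>j = l\<close> that truncation leaves over.\<close>
    also have "\<dots> = (\<Sum>j<Suc l. \<rho> ^ j * W j ?q) - 1"
      by (subst sum.lessThan_Suc_shift) (simp add: W_def)
    also have "\<dots> = h ?q + \<rho> ^ l * W l ?q - 1" by (simp add: h_def)
    also have "\<rho> ^ l * W l ?q \<le> \<rho> ^ l * (B * (real l + 1))"
      unfolding W_def by (rule mult_left_mono[OF B]) (use \<rho> in simp)
    also have "\<dots> < 1" using l by (simp add: algebra_simps)
    finally show ?thesis by simp
  qed
  \<comment> \<open>The factor \<open>h\<close> of the next state in the bet cancels the denominator
    from the induction hypothesis, so only the initial \<open>h\<close> survives, and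
    \<open>sum_wt\<close> costs one factor \<rho> per letter. Quantifying over \<open>u\<close>
    keeps the states reachable, as \<open>sum_wt\<close> demands.\<close>
  have step: "word_prob G (run C u) w \<ge>
      (1/2) ^ length (word_output C (run C u) w) * \<rho> ^ length w / h (run C u)" for u w
  proof (induction w arbitrary: u)
    case Nil
    then show ?case using h_ge[of "run C u"] h_pos[of "run C u"] by simp
  next
    case (Cons a w)
    let ?q = "run C u" and ?q' = "step C (run C u) a"
    have q': "run C (u @ [a]) = ?q'" by (simp add: run_def)
    let ?e = "(1/2 :: real) ^ length (emit C ?q a)"
    let ?o = "(1/2 :: real) ^ length (word_output C ?q' w) * \<rho> ^ length w"
    have "?e * ?o * \<rho> / h ?q \<le> ?e * ?o / (\<Sum>b\<in>UNIV. wt ?q b)"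
    proof -
      have "\<rho> / h ?q \<le> 1 / (\<Sum>b\<in>UNIV. wt ?q b)"
        using sum_wt[of u] sum_pos[of ?q] h_pos[of ?q] by (simp add: field_simps)
      then have "(?e * ?o) * (\<rho> / h ?q) \<le> (?e * ?o) * (1 / (\<Sum>b\<in>UNIV. wt ?q b))"
        by (rule mult_left_mono) (use \<rho> in simp)
      then show ?thesis by simp
    qed
    also have "\<dots> = pmf (bet G ?q) a * (?o / h ?q')"
      using h_pos[of ?q'] by (simp add: bet wt_def)
    also have "\<dots> \<le> pmf (bet G ?q) a * word_prob G ?q' w"
      using Cons.IH[of "u @ [a]"] by (intro mult_left_mono) (auto simp: q')
    finally show ?case by (simp add: G_def power_add mult_ac)
  qed
  show thesis
  proof (rule that[of G "1 / h (start C)"])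
    show "G \<in> FSG" by fact
    show "1 / h (start C) > 0" using h_pos by simp
    show "word_prob G (start G) w \<ge>
        1 / h (start C) * (1/2) ^ length (compress C w) * \<rho> ^ length w" for w
      using step[of "[]" w] by (simp add: run_def compress_eq_word_output G_def)
  qed
qed


subsection \<open>From gamblers to compressors\<close>

lemma unary_header_inj:
  "replicate i True @ False # x = replicate j True @ False # y \<Longrightarrow> i = j \<and> x = y"
proof (induction i arbitrary: j)
  case 0
  then show ?case by (cases j) auto
next
  case (Suc i)
  then show ?case by (cases j) auto
qed

text \<open>The codeword of \<open>v\<close> is the unary number \<open>i\<close> followed by \<open>t * i\<close> bits, where \<open>i\<close> is least with
  \<open>2\<^bsup>-t i\<^esup> \<le> f v\<close>; at most \<open>2\<^bsup>t i\<^esup>\<close> elements share a given \<open>i\<close>.\<close>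

lemma ex_prefix_code:
  fixes f :: "'b \<Rightarrow> real"
  assumes fin: "finite A" and pos: "\<And>v. v \<in> A \<Longrightarrow> 0 < f v" and sum: "sum f A \<le> 1" and t: "t > 0"
  shows "\<exists>c :: 'b \<Rightarrow> bool list.
    (\<forall>v\<in>A. \<forall>v'\<in>A. \<forall>x y. c v @ x = c v' @ y \<longrightarrow> v = v') \<and>
    (\<forall>v\<in>A. c v \<noteq> [] \<and> real (length (c v)) \<le> (1 + 1 / real t) * log 2 (1 / f v) + real t + 2)"
proof -
  define i where "i v = (LEAST i. (1/2) ^ (t * i) \<le> f v)" for v
  define A' where "A' j = {v \<in> A. (1/2) ^ (t * j) \<le> f v}" for j
  \<comment> \<open>Markov's inequality: the total mass is at most 1 and every element of
    \<open>A' j\<close> has mass at least \<open>(1/2) ^ (t * j)\<close>. Elements with a smaller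
    index may also lie in \<open>A' j\<close>, which is harmless for an upper bound on its
    size.\<close>
  have "\<exists>b. b ` A' j \<subseteq> {x :: bool list. length x = t * j} \<and> inj_on b (A' j)" for j
  proof (rule card_le_inj)
    show "finite (A' j)" using fin by (simp add: A'_def)
    have "real (card (A' j)) * (1/2) ^ (t * j) \<le> sum f (A' j)"
      using sum_bounded_below[of "A' j" "(1/2) ^ (t * j)" f] by (simp add: A'_def)
    also have "\<dots> \<le> sum f A"
      using fin by (intro sum_mono2) (auto simp: A'_def intro: less_imp_le[OF pos])
    also note sum
    finally have "real (card (A' j)) \<le> 2 ^ (t * j)"
      by (simp add: power_divide field_simps)
    then have "real (card (A' j)) \<le> real (2 ^ (t * j))" by simp
    then show "card (A' j) \<le> card {x :: bool list. length x = t * j}"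
      unfolding card_bool_lists of_nat_le_iff .
  qed (simp add: finite_words)
  then obtain b where b: "\<And>j. b j ` A' j \<subseteq> {x :: bool list. length x = t * j}"
      "\<And>j. inj_on (b j) (A' j)"
    by metis
  define c where "c v = replicate (i v) True @ False # b (i v) v" for v
  have i_le: "(1/2) ^ (t * i v) \<le> f v" if v: "v \<in> A" for v
  proof -
    obtain n where n: "(1/2 :: real) ^ n < f v"
      using real_arch_pow_inv[OF pos[OF v], of "1/2"] by auto
    have "(1/2 :: real) ^ (t * n) \<le> (1/2) ^ n"
      using t by (intro power_decreasing) auto
    then have "(1/2) ^ (t * n) \<le> f v" using n by linarith
    then show ?thesis unfolding i_def by (rule LeastI)
  qed
  then have mem: "v \<in> A' (i v)" if "v \<in> A" for v using that by (simp add: A'_def)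
  then have len: "length (b (i v) v) = t * i v" if "v \<in> A" for v using that b(1) by blast
  have inj: "v = v'" if "v \<in> A" "v' \<in> A" and eq: "c v @ x = c v' @ y" for v v' x y
  proof -
    have "i v = i v' \<and> b (i v) v @ x = b (i v') v' @ y"
      using eq unfolding c_def append_assoc append_Cons by (rule unary_header_inj)
    then have "i v = i v'" "b (i v) v = b (i v) v'"
      using len[OF that(1)] len[OF that(2)] by auto
    then show ?thesis using inj_onD[OF b(2)[of "i v"]] mem that by metis
  qed
  have "real (length (c v)) \<le> (1 + 1 / real t) * log 2 (1 / f v) + real t + 2" if v: "v \<in> A" for v
  proof -
    have f: "0 < f v" "f v \<le> 1"
      using pos[OF v] member_le_sum[of v A f] fin sum v pos by (force intro: less_imp_le)+
    have eq: "length (c v) = (t + 1) * i v + 1" by (simp add: c_def len[OF v])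
    show ?thesis
    proof (cases "i v")
      case 0
      then show ?thesis using f by (simp add: eq)
    next
      case (Suc m)
      \<comment> \<open>Minimality of \<open>i v = m + 1\<close> makes the test fail at
        \<open>m\<close>. In the length \<open>(t + 1) * (m + 1) + 1\<close> the part
        \<open>t * m + m\<close> is paid by the logarithm, and \<open>t + 2\<close> is the cost of
        rounding up.\<close>
      have "\<not> (1/2) ^ (t * m) \<le> f v"
        using not_less_Least[of m "\<lambda>i. (1/2) ^ (t * i) \<le> f v"] Suc by (simp add: i_def)
      then have "2 powr (real (t * m)) \<le> 1 / f v"
        using f by (simp add: powr_realpow power_divide field_simps flip: of_nat_mult)
      then have "real t * real m \<le> log 2 (1 / f v)"
        using f by (simp add: le_log_iff)
      then have "(1 + 1 / real t) * (real t * real m) \<le> (1 + 1 / real t) * log 2 (1 / f v)"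
        by (rule mult_left_mono) simp
      moreover have "(1 + 1 / real t) * (real t * real m) = real t * real m + real m"
        using t by (simp add: algebra_simps)
      moreover have "real (length (c v)) = real t * real m + real m + real t + 2"
        by (simp add: eq Suc algebra_simps)
      ultimately show ?thesis by linarith
    qed
  qed
  then show ?thesis using inj by (intro exI[of _ c]) (auto simp: c_def)
qed

section \<open>Block coding by a finite-state machine\<close>

function block_output ::
    "nat \<Rightarrow> (nat \<Rightarrow> 'a list \<Rightarrow> bool list) \<Rightarrow> (nat \<Rightarrow> 'a \<Rightarrow> nat) \<Rightarrow> nat \<Rightarrow> 'a list \<Rightarrow> bool list" where
  "block_output l c \<delta> q w = (if l = 0 \<or> length w < l then []
     else c q (take l w) @ block_output l c \<delta> (foldl \<delta> q (take l w)) (drop l w))"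
  by auto
termination by (relation "Wellfounded.measure (\<lambda>(l, c, \<delta>, q, w). length w)") auto

text \<open>The gambler's state after the last complete block, together with the unfinished block,
  for which \<open>block_output\<close> emits nothing.\<close>

function block_state :: "nat \<Rightarrow> (nat \<Rightarrow> 'a \<Rightarrow> nat) \<Rightarrow> nat \<Rightarrow> 'a list \<Rightarrow> nat \<times> 'a list" where
  "block_state l \<delta> q w = (if l = 0 \<or> length w < l then (q, w)
     else block_state l \<delta> (foldl \<delta> q (take l w)) (drop l w))"
  by auto
termination by (relation "Wellfounded.measure (\<lambda>(l, \<delta>, q, w). length w)") auto

declare block_output.simps [simp del] block_state.simps [simp del]

text \<open>A state pairs the gambler's state at the start of the current block with the letters
  buffered since then, coded as a natural number because automata carry such states.\<close>

definition block_compressor ::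
    "'a::finite gambler \<Rightarrow> nat \<Rightarrow> (nat \<Rightarrow> 'a list \<Rightarrow> bool list) \<Rightarrow> 'a compressor" where
  "block_compressor G l c =
    \<lparr>states = to_nat ` (states G \<times> {u :: 'a list. length u < l}),
     step = \<lambda>n a. case from_nat n of (q, u) \<Rightarrow> to_nat
       (if Suc (length u) = l then (foldl (step G) q (u @ [a]), []) else (q, u @ [a])),
     start = to_nat (start G, [] :: 'a list),
     emit = \<lambda>n a. case from_nat n of (q, u) \<Rightarrow>
       if Suc (length u) = l then c q (u @ [a]) else []\<rparr>"

text \<open>A buffer \<open>u\<close> acts as though it were still unread in front of the input; the
  arbitrary buffer is what makes the induction over letters go through.\<close>

lemma block_compressor_run:
  assumes "length u < l"
  shows "word_output (block_compressor G l c) (to_nat (q, u)) w = block_output l c (step G) q (u @ w)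
       \<and> foldl (step (block_compressor G l c)) (to_nat (q, u)) w
           = to_nat (block_state l (step G) q (u @ w))"
  using assms
proof (induction w arbitrary: q u)
  case Nil
  then show ?case by (simp add: block_output.simps block_state.simps)
next
  case (Cons a w)
  show ?case
  proof (cases "Suc (length u) = l")
    case True
    then have "block_output l c (step G) q (u @ a # w)
        = c q (u @ [a]) @ block_output l c (step G) (foldl (step G) q (u @ [a])) w"
      and "block_state l (step G) q (u @ a # w)
        = block_state l (step G) (foldl (step G) q (u @ [a])) w"
      by (subst block_output.simps block_state.simps, force)+
    then show ?thesis
      using Cons.IH[of "[]" "foldl (step G) q (u @ [a])"] True
      by (simp add: block_compressor_def)
  next
    case False
    then show ?thesis
      using Cons.IH[of "u @ [a]" q] Cons.prems by (simp add: block_compressor_def)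
  qed
qed

text \<open>Nonempty codewords let the output reveal whether a block was completed. If so, the
  prefix property recovers the first block and with it the state that selects the next code; an
  unfinished block is read off the final state.\<close>

lemma block_output_inj:
  assumes l: "l > 0"
    and code: "\<And>q v v' x y. length v = l \<Longrightarrow> length v' = l \<Longrightarrow> c q v @ x = c q v' @ y \<Longrightarrow> v = v'"
    and ne: "\<And>q v. length v = l \<Longrightarrow> c q v \<noteq> []"
    and out: "block_output l c \<delta> q w = block_output l c \<delta> q w'"
    and st: "block_state l \<delta> q w = block_state l \<delta> q w'"
  shows "w = w'"
  using out st
proof (induction w arbitrary: q w' rule: length_induct)
  case (1 w)
  have short: "block_output l c \<delta> q v = [] \<longleftrightarrow> length v < l" for v
    using l ne[of "take l v" q] by (subst block_output.simps) auto
  show ?case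
  proof (cases "length w < l")
    case True
    then have "length w' < l" using "1.prems"(1) short by metis
    with True show ?thesis using "1.prems"(2) by (simp add: block_state.simps)
  next
    case False
    then have ge: "length w \<ge> l" "length w' \<ge> l" using "1.prems"(1) short by (metis not_less)+
    have out_eq: "block_output l c \<delta> q v
        = c q (take l v) @ block_output l c \<delta> (foldl \<delta> q (take l v)) (drop l v)"
      and st_eq: "block_state l \<delta> q v = block_state l \<delta> (foldl \<delta> q (take l v)) (drop l v)"
      if "length v \<ge> l" for v
      using that l by (subst block_output.simps block_state.simps, force)+
    have take_eq: "take l w = take l w'"
      by (rule code[of _ _ q]) (use ge "1.prems"(1) out_eq in auto)
    moreover have "drop l w = drop l w'"
      by (rule "1.IH"[rule_format, of _ "foldl \<delta> q (take l w)"])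
         (use l ge "1.prems" out_eq st_eq take_eq in auto)
    ultimately show ?thesis by (metis append_take_drop_id)
  qed
qed

lemma block_compressor_ILFSC:
  fixes G :: "'a::finite gambler"
  assumes "finite_automaton G" and l: "l > 0"
    and "\<And>q v v' x y. length v = l \<Longrightarrow> length v' = l \<Longrightarrow> c q v @ x = c q v' @ y \<Longrightarrow> v = v'"
    and "\<And>q v. length v = l \<Longrightarrow> c q v \<noteq> []"
  shows "block_compressor G l c \<in> ILFSC"
proof -
  let ?C = "block_compressor G l c"
  have "{u :: 'a list. length u < l} = (\<Union>j<l. {u. length u = j})" by auto
  then have "finite {u :: 'a list. length u < l}" by (simp add: finite_words)
  moreover have "step ?C (to_nat (q, u)) a \<in> states ?C"
    if "q \<in> states G" "length u < l" for q a and u :: "'a list"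
    using that l foldl_step_in_states[OF assms(1) that(1), of "u @ [a]"]
    by (auto simp: block_compressor_def)
  ultimately have "finite_automaton ?C"
    using assms(1) l by (auto simp: finite_automaton_def) (auto simp: block_compressor_def)
  moreover have "inj (\<lambda>w. (compress ?C w, run ?C w))"
  proof (rule injI)
    fix w w' assume eq: "(compress ?C w, run ?C w) = (compress ?C w', run ?C w')"
    have start: "start ?C = to_nat (start G, [] :: 'a list)"
      by (simp add: block_compressor_def)
    have "(compress ?C v, run ?C v) = (block_output l c (step G) (start G) v,
        to_nat (block_state l (step G) (start G) v))" for v
      using block_compressor_run[of "[]" l G c "start G" v] l
      by (simp add: compress_eq_word_output run_def start)
    with eq show "w = w'"
      by (intro block_output_inj[OF l assms(3,4), where \<delta> = "step G" and q = "start G"]) auto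
  qed
  ultimately show ?thesis by (simp add: ILFSC_def)
qed

text \<open>Averaging the block probabilities with the uniform ones costs one bit per block and gives
  codewords to blocks of probability zero.\<close>

lemma compressor_of_gambler:
  fixes G :: "'a::finite gambler"
  assumes G: "G \<in> FSG" and l: "l > 0" and t: "t > 0"
  obtains C where "C \<in> ILFSC"
    and "\<And>w. word_prob G (start G) w > 0 \<Longrightarrow> real (length (compress C w))
      \<le> (1 + 1 / real t) * log 2 (1 / word_prob G (start G) w) + (real t + 4) * (real (length w) / real l)"
proof -
  define f where "f q v = (word_prob G q v + 1 / real CARD('a) ^ l) / 2" for q and v :: "'a list"
  have card: "card {v :: 'a list. length v = l} = CARD('a) ^ l"
    using card_lists_length_eq[of "UNIV :: 'a set" l] by simp
  have sum_f: "(\<Sum>v | length v = l. f q v) = 1" for q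
    by (simp add: f_def sum.distrib card sum_word_prob flip: sum_divide_distrib)
  have f_pos: "f q v > 0" for q v
    using word_prob_nonneg[of G q v] by (simp add: f_def add_nonneg_pos)
  have "\<forall>q. \<exists>c :: 'a list \<Rightarrow> bool list.
      (\<forall>v\<in>{v. length v = l}. \<forall>v'\<in>{v. length v = l}. \<forall>x y. c v @ x = c v' @ y \<longrightarrow> v = v') \<and>
      (\<forall>v\<in>{v. length v = l}. c v \<noteq> [] \<and>
        real (length (c v)) \<le> (1 + 1 / real t) * log 2 (1 / f q v) + real t + 2)"
    by (intro allI ex_prefix_code) (use t f_pos sum_f in \<open>auto simp: finite_words\<close>)
  then obtain c :: "nat \<Rightarrow> 'a list \<Rightarrow> bool list" where code: "\<And>q.
      (\<forall>v\<in>{v. length v = l}. \<forall>v'\<in>{v. length v = l}. \<forall>x y. c q v @ x = c q v' @ y \<longrightarrow> v = v') \<and>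
      (\<forall>v\<in>{v. length v = l}. c q v \<noteq> [] \<and>
        real (length (c q v)) \<le> (1 + 1 / real t) * log 2 (1 / f q v) + real t + 2)"
    by (subst (asm) choice_iff) blast
  have c: "length v = l \<Longrightarrow> length v' = l \<Longrightarrow> c q v @ x = c q v' @ y \<Longrightarrow> v = v'"
    "length v = l \<Longrightarrow> c q v \<noteq> []"
    "length v = l \<Longrightarrow>
       real (length (c q v)) \<le> (1 + 1 / real t) * log 2 (1 / f q v) + real t + 2" for q v v' x y
    using code[of q] by (simp, blast, simp_all)
  let ?C = "block_compressor G l c"
  let ?I = "\<lambda>q v. log 2 (1 / word_prob G q v)"
  have c_len: "real (length (c q v)) \<le> (1 + 1 / real t) * ?I q v + real t + 4"
    if "length v = l" and P: "word_prob G q v > 0" for q v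
  proof -
    \<comment> \<open>Dropping the uniform half of \<open>f\<close> costs one bit; multiplied by
      \<open>1 + 1 / real t \<le> 2\<close>, it raises the constant from \<open>t + 2\<close> to
      \<open>t + 4\<close>.\<close>
    have "word_prob G q v / 2 \<le> f q v" by (simp add: f_def)
    then have "log 2 (1 / f q v) \<le> log 2 (1 / (word_prob G q v / 2))"
      using P f_pos[of q v] by (simp add: field_simps)
    also have "\<dots> = ?I q v + 1" using P by (simp add: log_divide)
    finally have "(1 + 1 / real t) * log 2 (1 / f q v) \<le> (1 + 1 / real t) * (?I q v + 1)"
      by (rule mult_left_mono) simp
    moreover have "(1 + 1 / real t) * (?I q v + 1) \<le> (1 + 1 / real t) * ?I q v + 2"
      using t by (simp add: algebra_simps)
    ultimately show ?thesis using c(3)[OF that(1), of q] by linarith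
  qed
  \<comment> \<open>Induction over blocks: logarithms add along the run and every complete block
    pays \<open>t + 4\<close>. An unfinished block emits nothing, and there the right side is
    nonnegative because \<open>word_prob\<close> is at most 1.\<close>
  have bound: "real (length (block_output l c (step G) q w))
      \<le> (1 + 1 / real t) * ?I q w + (real t + 4) * (real (length w) / real l)"
    if "word_prob G q w > 0" for q w
    using that
  proof (induction w arbitrary: q rule: length_induct)
    case (1 w)
    show ?case
    proof (cases "length w < l")
      case True
      then show ?thesis
        using "1.prems" word_prob_le_1[of G q w] by (simp add: block_output.simps)
    next
      case False
      let ?u = "take l w" and ?v = "drop l w"
      let ?q = "foldl (step G) q ?u"
      have P: "word_prob G q w = word_prob G q ?u * word_prob G ?q ?v"
        by (simp flip: word_prob_append)
      have pos: "word_prob G q ?u > 0" "word_prob G ?q ?v > 0"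
        using "1.prems" word_prob_nonneg[of G q ?u] word_prob_nonneg[of G ?q ?v]
        by (auto simp: P zero_less_mult_iff)
      have I: "?I q w = ?I q ?u + ?I ?q ?v"
        using pos by (simp add: P log_divide log_mult)
      have IH: "real (length (block_output l c (step G) ?q ?v))
          \<le> (1 + 1 / real t) * ?I ?q ?v + (real t + 4) * (real (length ?v) / real l)"
        by (rule "1.IH"[rule_format]) (use pos(2) False l in auto)
      have "length (block_output l c (step G) q w)
          = length (c q ?u) + length (block_output l c (step G) ?q ?v)"
        using False l by (subst block_output.simps) simp
      moreover have "real (length w) / real l = 1 + real (length ?v) / real l"
        using False l by (simp add: field_simps)
      ultimately show ?thesis
        using IH c_len[OF _ pos(1)] False by (simp add: I algebra_simps)
    qed
  qed
  show thesis
  proof (rule that)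
    show "?C \<in> ILFSC"
      using G by (intro block_compressor_ILFSC c l) (auto simp: FSG_def)
    have "compress ?C w = block_output l c (step G) (start G) w" for w
      using block_compressor_run[of "[]" l G c "start G" w] l
      by (simp add: compress_eq_word_output block_compressor_def)
    then show "word_prob G (start G) w > 0 \<Longrightarrow> real (length (compress ?C w))
        \<le> (1 + 1 / real t) * ?I (start G) w + (real t + 4) * (real (length w) / real l)" for w
      using bound by simp
  qed
qed


subsection \<open>The two dimensions\<close>

lemma length_seq_prefix [simp]: "length (seq_prefix S n) = n"
  by (simp add: seq_prefix_def)

section \<open>Infinite upper and lower limits as frequent and eventual bounds\<close>

lemma limsup_eq_PInfty_iff:
  "limsup (\<lambda>n. ereal (X n)) = \<infinity> \<longleftrightarrow> (\<forall>M. \<exists>\<^sub>F n in sequentially. M < X n)"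
proof
  assume L: "limsup (\<lambda>n. ereal (X n)) = \<infinity>"
  show "\<forall>M. \<exists>\<^sub>F n in sequentially. M < X n"
  proof (rule allI, rule ccontr)
    fix M assume "\<not> (\<exists>\<^sub>F n in sequentially. M < X n)"
    then have "\<forall>\<^sub>F n in sequentially. ereal (X n) \<le> ereal M"
      by (simp add: not_frequently not_less)
    then have "limsup (\<lambda>n. ereal (X n)) \<le> ereal M" by (rule Limsup_bounded)
    with L show False by simp
  qed
next
  assume freq: "\<forall>M. \<exists>\<^sub>F n in sequentially. M < X n"
  show "limsup (\<lambda>n. ereal (X n)) = \<infinity>"
  proof (rule ccontr)
    assume "limsup (\<lambda>n. ereal (X n)) \<noteq> \<infinity>"
    then have "limsup (\<lambda>n. ereal (X n)) < \<infinity>" by simp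
    then obtain M where "limsup (\<lambda>n. ereal (X n)) < ereal M"
      using ereal_dense2 by blast
    then have "\<forall>\<^sub>F n in sequentially. \<not> M < X n"
      by (rule Limsup_lessD[THEN eventually_mono]) simp
    with freq show False by (simp add: frequently_def)
  qed
qed

lemma liminf_eq_PInfty_iff:
  "liminf (\<lambda>n. ereal (X n)) = \<infinity> \<longleftrightarrow> (\<forall>M. \<forall>\<^sub>F n in sequentially. M < X n)"
proof
  assume L: "liminf (\<lambda>n. ereal (X n)) = \<infinity>"
  show "\<forall>M. \<forall>\<^sub>F n in sequentially. M < X n"
  proof
    fix M
    have "\<forall>\<^sub>F n in sequentially. ereal M < ereal (X n)"
      by (rule less_LiminfD) (simp add: L)
    then show "\<forall>\<^sub>F n in sequentially. M < X n" by simp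
  qed
next
  assume "\<forall>M. \<forall>\<^sub>F n in sequentially. M < X n"
  then have "(\<lambda>n. ereal (X n)) \<longlonglongrightarrow> \<infinity>" by (simp add: tendsto_PInfty)
  then show "liminf (\<lambda>n. ereal (X n)) = \<infinity>" by (rule lim_imp_Liminf[OF sequentially_bot])
qed

lemma liminf_less_imp_frequently:
  fixes X :: "nat \<Rightarrow> 'b :: complete_linorder"
  assumes "liminf X < r"
  shows "\<exists>\<^sub>F n in sequentially. X n < r"
proof (rule ccontr)
  assume "\<not> ?thesis"
  then have "\<forall>\<^sub>F n in sequentially. r \<le> X n" by (simp add: not_frequently not_less)
  then have "r \<le> liminf X" by (rule Liminf_bounded)
  with assms show False by simp
qed

lemma liminf_le_of_frequently:
  fixes X :: "nat \<Rightarrow> 'b :: complete_linorder"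
  assumes "\<exists>\<^sub>F n in sequentially. X n \<le> r"
  shows "liminf X \<le> r"
proof (rule ccontr)
  assume "\<not> ?thesis"
  then have "\<forall>\<^sub>F n in sequentially. r < X n" by (intro less_LiminfD) simp
  with assms show False by (simp add: frequently_def not_le)
qed

section \<open>Gale growth against compression ratio\<close>

context
  fixes \<beta> :: "'a::finite pmf" and S :: "nat \<Rightarrow> 'a"
  assumes card: "CARD('a) \<ge> 2" and pos: "positive_pmf \<beta>"
begin

text \<open>Stated as an implication for each large \<open>n\<close>, so that it transfers both
  frequent and eventual smallness of the ratio.\<close>

lemma ex_gambler:
  assumes C: "C \<in> ILFSC" and "r < s"
  obtains G where "G \<in> FSG" and "\<And>M. \<forall>\<^sub>F n in sequentially.
    compression_ratio C \<beta> (seq_prefix S n) < r \<longrightarrow> M < gale G s \<beta> (seq_prefix S n)"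
proof -
  obtain c where c: "c > 0" "\<And>w. c * real (length w) \<le> self_information \<beta> w"
    by (rule self_information_ge_linear[OF card pos]) blast
  \<comment> \<open>Half of the gap \<open>s - r\<close> pays for the powers of \<rho>, the other
    half makes the gale grow exponentially. Accordingly \<rho> is taken so near 1 that its loss on
    \<open>w\<close> is at most \<open>e\<close> times the self-information.\<close>
  define e where "e = (s - r) / 2"
  have e: "e > 0" using assms by (simp add: e_def)
  have "2 powr (- (e * c)) < 2 powr 0" using e c by (intro powr_less_mono) auto
  then obtain \<rho> where \<rho>: "\<rho> \<in> \<rat>" "2 powr (- (e * c)) < \<rho>" "\<rho> < 1"
    using Rats_dense_in_real[of "2 powr (- (e * c))" 1] by auto
  have \<rho>_pos: "\<rho> > 0" using \<rho>(2) by (rule le_less_trans[rotated]) simp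
  obtain G K where G: "G \<in> FSG" and K: "K > 0"
    and P: "\<And>w. word_prob G (start G) w \<ge> K * (1/2) ^ length (compress C w) * \<rho> ^ length w"
    by (rule gambler_of_compressor[OF C \<rho>(1) \<rho>_pos \<rho>(3)]) blast
  have gale_ge: "gale G s \<beta> w \<ge> K * (2 powr (e * c)) ^ length w"
    if "compression_ratio C \<beta> w < r" "length w > 0" for w
  proof -
    let ?I = "self_information \<beta> w"
    have I: "?I > 0" using c(1) that(2) by (intro less_le_trans[OF _ c(2)[of w]]) simp
    then have "real (length (compress C w)) < r * ?I"
      using that(1) by (simp add: compression_ratio_def field_simps)
    then have "2 powr (- (r * ?I)) \<le> 2 powr (- real (length (compress C w)))"
      by simp
    also have "\<dots> = (1/2) ^ length (compress C w)"
      by (simp add: powr_minus powr_realpow power_one_over inverse_eq_divide)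
    finally have C_ge: "2 powr (- (r * ?I)) \<le> (1/2) ^ length (compress C w)" .
    have "2 powr (- (e * ?I)) \<le> (2 powr (- (e * c))) ^ length w"
      using mult_left_mono[OF c(2)[of w], of e] e by (simp add: powr_power mult_ac)
    also have "\<dots> \<le> \<rho> ^ length w"
      using \<rho> by (intro power_mono) auto
    finally have \<rho>_ge: "2 powr (- (e * ?I)) \<le> \<rho> ^ length w" .
    have "(2 powr (e * c)) ^ length w \<le> 2 powr (e * ?I)"
      using mult_left_mono[OF c(2)[of w], of e] e by (simp add: powr_power mult_ac)
    also have "e * ?I = s * ?I + (- (r * ?I) + - (e * ?I))"
      by (simp add: e_def field_simps)
    also have "2 powr \<dots> = 2 powr (s * ?I) * (2 powr (- (r * ?I)) * 2 powr (- (e * ?I)))"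
      by (simp only: powr_add)
    also have "\<dots> \<le> 2 powr (s * ?I) * ((1/2) ^ length (compress C w) * \<rho> ^ length w)"
      using C_ge \<rho>_ge \<rho>_pos by (intro mult_left_mono mult_mono) auto
    finally have "K * (2 powr (e * c)) ^ length w
        \<le> K * (2 powr (s * ?I) * ((1/2) ^ length (compress C w) * \<rho> ^ length w))"
      by (rule mult_left_mono) (use K in simp)
    also have "\<dots> = 2 powr (s * ?I) * (K * (1/2) ^ length (compress C w) * \<rho> ^ length w)"
      by (simp add: mult_ac)
    also have "\<dots> \<le> gale G s \<beta> w"
      unfolding gale_eq[OF pos] by (rule mult_left_mono[OF P]) simp
    finally show ?thesis .
  qed
  show thesis
  proof (rule that[OF G])
    fix M
    have "2 powr (e * c) > 1" using e c by simp
    then obtain N where N: "M / K < (2 powr (e * c)) ^ N"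
      using real_arch_pow by blast
    have "\<forall>\<^sub>F n in sequentially. M < K * (2 powr (e * c)) ^ n"
      using eventually_ge_at_top[of N]
    proof eventually_elim
      case (elim n)
      have "(2 powr (e * c)) ^ N \<le> (2 powr (e * c)) ^ n"
        using elim \<open>2 powr (e * c) > 1\<close> by (intro power_increasing) auto
      with N have "M / K < (2 powr (e * c)) ^ n" by (rule less_le_trans)
      with K show ?case by (simp add: field_simps)
    qed
    then show "\<forall>\<^sub>F n in sequentially.
        compression_ratio C \<beta> (seq_prefix S n) < r \<longrightarrow> M < gale G s \<beta> (seq_prefix S n)"
      using eventually_gt_at_top[of 0]
    proof eventually_elim
      case (elim n)
      then show ?case using gale_ge[of "seq_prefix S n"] by auto
    qed
  qed
qed

text \<open>A gale above 1 means \<open>log 2 (1 / P) \<le> s * I\<close>, with \<open>P\<close> the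
  product of the bets and \<open>I\<close> the self-information. The claim is for single words, so
  it serves both kinds of success.\<close>

lemma ex_compressor:
  assumes G: "G \<in> FSG" and s: "0 \<le> s" and e: "0 < e"
  obtains C where "C \<in> ILFSC"
    and "\<And>w. 1 < gale G s \<beta> w \<Longrightarrow> compression_ratio C \<beta> w \<le> s + e"
proof -
  obtain c where c: "c > 0" "\<And>w. c * real (length w) \<le> self_information \<beta> w"
    by (rule self_information_ge_linear[OF card pos]) blast
  \<comment> \<open>The slack \<open>e\<close> is split in two: \<open>t\<close> makes
    \<open>s / t\<close> at most \<open>e / 2\<close>, and then \<open>l\<close>, chosen after
    \<open>t\<close>, makes the block overhead at most \<open>e / 2\<close> times the
    self-information.\<close>
  obtain t :: nat where t: "2 * s / e < real t" "t > 0"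
    using reals_Archimedean2[of "max (2 * s / e) 0"] by auto
  obtain l :: nat where l: "2 * (real t + 4) / (c * e) < real l" "l > 0"
    using reals_Archimedean2[of "max (2 * (real t + 4) / (c * e)) 0"] by auto
  obtain C where C: "C \<in> ILFSC"
    and len: "\<And>w. word_prob G (start G) w > 0 \<Longrightarrow> real (length (compress C w))
      \<le> (1 + 1 / real t) * log 2 (1 / word_prob G (start G) w) + (real t + 4) * (real (length w) / real l)"
    by (rule compressor_of_gambler[OF G l(2) t(2)]) blast
  show thesis
  proof (rule that[OF C])
    fix w assume gale: "1 < gale G s \<beta> w"
    let ?P = "word_prob G (start G) w" and ?I = "self_information \<beta> w"
    have P: "?P > 0"
      using gale word_prob_nonneg[of G "start G" w] by (cases "?P = 0") (auto simp: gale_eq[OF pos])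
    have I: "?I \<ge> 0" using c(1) c(2)[of w] by (smt (verit) mult_nonneg_nonneg of_nat_0_le_iff)
    have "1 / ?P \<le> 2 powr (s * ?I)"
      using gale P by (simp add: gale_eq[OF pos] field_simps)
    then have "log 2 (1 / ?P) \<le> s * ?I" using P by (simp add: log_le_iff)
    then have "(1 + 1 / real t) * log 2 (1 / ?P) \<le> (1 + 1 / real t) * (s * ?I)"
      by (rule mult_left_mono) simp
    also have "\<dots> = s * ?I + (s / real t) * ?I" by (simp add: algebra_simps)
    also have "\<dots> \<le> s * ?I + (e / 2) * ?I"
      by (intro add_left_mono mult_right_mono) (use t e I in \<open>auto simp: field_simps\<close>)
    finally have 1: "(1 + 1 / real t) * log 2 (1 / ?P) \<le> s * ?I + (e / 2) * ?I" .
    have "(real t + 4) * (real (length w) / real l) = (real t + 4) / real l * real (length w)"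
      by simp
    also have "\<dots> \<le> (e / 2 * c) * real (length w)"
      by (rule mult_right_mono) (use l e c in \<open>auto simp: field_simps\<close>)
    also have "\<dots> \<le> (e / 2) * ?I"
      using mult_left_mono[OF c(2)[of w], of "e / 2"] e by (simp add: mult.assoc)
    finally have "real (length (compress C w)) \<le> s * ?I + (e / 2) * ?I + (e / 2) * ?I"
      using len[OF P] 1 by linarith
    then have "real (length (compress C w)) \<le> (s + e) * ?I" by (simp add: algebra_simps)
    then show "compression_ratio C \<beta> w \<le> s + e"
      \<comment> \<open>With zero self-information the ratio is 0 by the convention for division by
        zero.\<close>
      using I s e by (cases "?I = 0") (auto simp: compression_ratio_def field_simps)
  qed
qed

lemma compression_ratio_nonneg: "0 \<le> compression_ratio C \<beta> w"
proof -
  obtain c where "c > 0" "c * real (length w) \<le> self_information \<beta> w"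
    by (rule self_information_ge_linear[OF card pos]) blast
  then have "0 \<le> self_information \<beta> w" by (smt (verit) mult_nonneg_nonneg of_nat_0_le_iff)
  then show ?thesis by (simp add: compression_ratio_def)
qed

section \<open>The four inequalities between dimensions and compression ratios\<close>

lemma dim_FS_le_liminf:
  assumes "C \<in> ILFSC"
  shows "dim_FS \<beta> S \<le> liminf (\<lambda>n. ereal (compression_ratio C \<beta> (seq_prefix S n)))"
    (is "_ \<le> ?L")
proof (rule dense_ge)
  fix x assume "?L < x"
  then obtain r where r: "?L < ereal r" "ereal r < x" using ereal_dense2 by blast
  then obtain s where s: "ereal r < ereal s" "ereal s < x" using ereal_dense2 by blast
  have freq: "\<exists>\<^sub>F n in sequentially. compression_ratio C \<beta> (seq_prefix S n) < r"
    using liminf_less_imp_frequently[OF r(1)] by simp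
  \<comment> \<open>One prefix with ratio below \<open>r\<close> already shows \<open>r > 0\<close>,
    which makes \<open>s\<close> an admissible exponent in the infimum.\<close>
  obtain n where "compression_ratio C \<beta> (seq_prefix S n) < r"
    using frequently_ex[OF freq] by blast
  with compression_ratio_nonneg have "0 < r" by (rule le_less_trans)
  obtain G where G: "G \<in> FSG" and ev: "\<And>M. \<forall>\<^sub>F n in sequentially.
      compression_ratio C \<beta> (seq_prefix S n) < r \<longrightarrow> M < gale G s \<beta> (seq_prefix S n)"
    using ex_gambler[OF assms, of r s] s(1) by auto
  have "succeeds (gale G s \<beta>) S"
    unfolding succeeds_def limsup_eq_PInfty_iff
  proof
    fix M
    show "\<exists>\<^sub>F n in sequentially. M < gale G s \<beta> (seq_prefix S n)"
      using frequently_mp[OF ev freq] .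
  qed
  then have "dim_FS \<beta> S \<le> ereal s"
    unfolding dim_FS_def using G \<open>0 < r\<close> s(1) by (intro Inf_lower) auto
  with s(2) show "dim_FS \<beta> S \<le> x" by simp
qed

lemma strong_dim_FS_le_limsup:
  assumes "C \<in> ILFSC"
  shows "strong_dim_FS \<beta> S \<le> limsup (\<lambda>n. ereal (compression_ratio C \<beta> (seq_prefix S n)))"
    (is "_ \<le> ?L")
proof (rule dense_ge)
  fix x assume "?L < x"
  then obtain r where r: "?L < ereal r" "ereal r < x" using ereal_dense2 by blast
  then obtain s where s: "ereal r < ereal s" "ereal s < x" using ereal_dense2 by blast
  have ev_r: "\<forall>\<^sub>F n in sequentially. compression_ratio C \<beta> (seq_prefix S n) < r"
    using Limsup_lessD[OF r(1)] by simp
  obtain n where "compression_ratio C \<beta> (seq_prefix S n) < r"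
    using eventually_happens'[OF sequentially_bot ev_r] by blast
  with compression_ratio_nonneg have "0 < r" by (rule le_less_trans)
  obtain G where G: "G \<in> FSG" and ev: "\<And>M. \<forall>\<^sub>F n in sequentially.
      compression_ratio C \<beta> (seq_prefix S n) < r \<longrightarrow> M < gale G s \<beta> (seq_prefix S n)"
    using ex_gambler[OF assms, of r s] s(1) by auto
  have "succeeds_strongly (gale G s \<beta>) S"
    unfolding succeeds_strongly_def liminf_eq_PInfty_iff
  proof
    fix M
    show "\<forall>\<^sub>F n in sequentially. M < gale G s \<beta> (seq_prefix S n)"
      using eventually_mp[OF ev ev_r] .
  qed
  then have "strong_dim_FS \<beta> S \<le> ereal s"
    unfolding strong_dim_FS_def using G \<open>0 < r\<close> s(1) by (intro Inf_lower) auto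
  with s(2) show "strong_dim_FS \<beta> S \<le> x" by simp
qed

lemma liminf_le_dim_FS:
  "(INF C\<in>ILFSC. liminf (\<lambda>n. ereal (compression_ratio C \<beta> (seq_prefix S n)))) \<le> dim_FS \<beta> S"
  unfolding dim_FS_def
proof (rule Inf_greatest, clarsimp)
  fix s G assume s: "0 \<le> s" and G: "G \<in> FSG" and "succeeds (gale G s \<beta>) S"
  then have freq: "\<exists>\<^sub>F n in sequentially. 1 < gale G s \<beta> (seq_prefix S n)"
    by (simp add: succeeds_def limsup_eq_PInfty_iff)
  show "(INF C\<in>ILFSC. liminf (\<lambda>n. ereal (compression_ratio C \<beta> (seq_prefix S n)))) \<le> ereal s"
  \<comment> \<open>The compressor depends on \<open>e\<close>, so the bound by \<open>s\<close>
    holds only for the infimum over all compressors.\<close>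
  proof (rule ereal_le_epsilon2)
    fix e :: real assume "0 < e"
    then obtain C where C: "C \<in> ILFSC"
      and le: "\<And>w. 1 < gale G s \<beta> w \<Longrightarrow> compression_ratio C \<beta> w \<le> s + e"
      using ex_compressor[OF G s] by metis
    have "liminf (\<lambda>n. ereal (compression_ratio C \<beta> (seq_prefix S n))) \<le> ereal (s + e)"
      by (rule liminf_le_of_frequently, rule frequently_elim1[OF freq]) (simp add: le)
    then show "(INF C\<in>ILFSC. liminf (\<lambda>n. ereal (compression_ratio C \<beta> (seq_prefix S n))))
        \<le> ereal s + ereal e"
      using C by (auto intro: INF_lower2)
  qed
qed

lemma limsup_le_strong_dim_FS:
  "(INF C\<in>ILFSC. limsup (\<lambda>n. ereal (compression_ratio C \<beta> (seq_prefix S n)))) \<le> strong_dim_FS \<beta> S"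
  unfolding strong_dim_FS_def
proof (rule Inf_greatest, clarsimp)
  fix s G assume s: "0 \<le> s" and G: "G \<in> FSG" and "succeeds_strongly (gale G s \<beta>) S"
  then have ev: "\<forall>\<^sub>F n in sequentially. 1 < gale G s \<beta> (seq_prefix S n)"
    by (simp add: succeeds_strongly_def liminf_eq_PInfty_iff)
  show "(INF C\<in>ILFSC. limsup (\<lambda>n. ereal (compression_ratio C \<beta> (seq_prefix S n)))) \<le> ereal s"
  proof (rule ereal_le_epsilon2)
    fix e :: real assume "0 < e"
    then obtain C where C: "C \<in> ILFSC"
      and le: "\<And>w. 1 < gale G s \<beta> w \<Longrightarrow> compression_ratio C \<beta> w \<le> s + e"
      using ex_compressor[OF G s] by metis
    have "limsup (\<lambda>n. ereal (compression_ratio C \<beta> (seq_prefix S n))) \<le> ereal (s + e)"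
      by (rule Limsup_bounded, rule eventually_mono[OF ev]) (simp add: le)
    then show "(INF C\<in>ILFSC. limsup (\<lambda>n. ereal (compression_ratio C \<beta> (seq_prefix S n))))
        \<le> ereal s + ereal e"
      using C by (auto intro: INF_lower2)
  qed
qed

end

theorem theorem4p3:
  fixes \<beta> :: "'a::finite pmf" and S :: "nat \<Rightarrow> 'a"
  assumes "CARD('a) \<ge> 2" and "positive_pmf \<beta>"
  shows "dim_FS \<beta> S =
           (INF C\<in>ILFSC. liminf (\<lambda>n. ereal (compression_ratio C \<beta> (seq_prefix S n)))) \<and>
         strong_dim_FS \<beta> S =
           (INF C\<in>ILFSC. limsup (\<lambda>n. ereal (compression_ratio C \<beta> (seq_prefix S n))))"
proof
  show "dim_FS \<beta> S =
      (INF C\<in>ILFSC. liminf (\<lambda>n. ereal (compression_ratio C \<beta> (seq_prefix S n))))"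
    using dim_FS_le_liminf[OF assms] liminf_le_dim_FS[OF assms]
    by (intro order.antisym INF_greatest)
  show "strong_dim_FS \<beta> S =
      (INF C\<in>ILFSC. limsup (\<lambda>n. ereal (compression_ratio C \<beta> (seq_prefix S n))))"
    using strong_dim_FS_le_limsup[OF assms] limsup_le_strong_dim_FS[OF assms]
    by (intro order.antisym INF_greatest)
qed

end
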